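(* Let $m\in\mathbb{N}$ and $M_k\ge 0$ for $k=0,1,2,\ldots,m-1$. Let $F(z)=\sum_{k=0}^{m-1}\overline{z}^k f_k(z)$ be a poly-analytic function of order $m$ in the unit disk $\mathbb{D}$, where all the $f_k$ are holomorphic in $\mathbb{D}$, satisfying $F_z(0)=1$ and $f_k(0)=0$ for $k\in\{0,1,2,\ldots,m-1\}$. If $|f_k(z)|\le M_k$ for all $k\in\{0,1,2,\ldots,m-1\}$ and all $z\in\mathbb{D}$, then $M_0\ge 1$, $F$ is univalent in $\mathbb{D}_{r_2}$, and $F(\mathbb{D}_{r_2})$ contains the schlicht disk $\mathbb{D}_{r_3}$, where $r_2$ is the unique root in $(0,1)$ of the equation $$1-\left(M_0-\frac{1}{M_0}\right)\frac{(2-r)r}{(1-r)^2}-\sum_{k=1}^{m-1}r^k\frac{M_k}{1-r^2}-\sum_{k=1}^{m-1}k r^k M_k=0$$ and $$r_3=r_2-\left(M_0-\frac{1}{M_0}\right)\frac{r_2^2}{1-r_2}-\sum_{k=1}^{m-1}M_k r_2^k.$$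
   Context: $\mathbb{D}_r=\{z\in\mathbb{C}:|z|<r\}$ and $\mathbb{D}=\mathbb{D}_1$; $\mathbb{N}=\{1,2,\ldots\}$. A poly-analytic function of order $m$ in a domain $\Omega$ is a function of the form $F(z)=\sum_{k=0}^{m-1}\overline{z}^k f_k(z)$ with all $f_k$ analytic in $\Omega$. $F_z$ and $F_{\overline z}$ denote the Wirtinger derivatives $\frac12(F_x-iF_y)$ and $\frac12(F_x+iF_y)$. Univalent means injective. A schlicht disk in the image of $F$ is a disk that is the univalent image under $F$ of some region in the domain. Empty sums are $0$.
   Formalization: Existence and uniqueness of the root r_2 is claimed only when M_0 ≠ 1 or some M_k ≠ 0 with 1 ≤ k ≤ m-1; otherwise (e.g. F(z)=z) the equation reads 1=0 and r_2 does not exist, so univalence and covering claims are then void; M_0 ≥ 1 is always asserted. *)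

theory Defs
  imports "HOL-Complex_Analysis.Complex_Analysis"
begin

text \<open>As is usual for ``order \<open>m\<close>'', the leading component \<open>f (m - 1)\<close> may vanish.\<close>

definition polyanalytic_with ::
    "complex set \<Rightarrow> nat \<Rightarrow> (nat \<Rightarrow> complex \<Rightarrow> complex) \<Rightarrow> (complex \<Rightarrow> complex) \<Rightarrow> bool" where
  "polyanalytic_with \<Omega> m f F \<longleftrightarrow>
     (\<forall>k<m. f k holomorphic_on \<Omega>) \<and> (\<forall>z\<in>\<Omega>. F z = (\<Sum>k<m. cnj z ^ k * f k z))"

text \<open>The Wirtinger derivative $F_z = \frac12 (F_x - i F_y)$, with the partial derivatives
  taken along the real and the imaginary direction.\<close>

definition wirtinger_z :: "(complex \<Rightarrow> complex) \<Rightarrow> complex \<Rightarrow> complex" where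
  "wirtinger_z F z =
     (vector_derivative (\<lambda>t::real. F (z + of_real t)) (at 0)
       - \<i> * vector_derivative (\<lambda>t::real. F (z + \<i> * of_real t)) (at 0)) / 2"

text \<open>The disk is the univalent image of a region \<open>U \<subseteq> \<Omega>\<close>. If \<open>r > 0\<close>, such a \<open>U\<close> is
  nonempty; for \<open>r \<le> 0\<close> the disk is empty and the condition holds with \<open>U = {}\<close>.\<close>

definition contains_schlicht_disk ::
    "(complex \<Rightarrow> complex) \<Rightarrow> complex set \<Rightarrow> complex \<Rightarrow> real \<Rightarrow> bool" where
  "contains_schlicht_disk F \<Omega> c r \<longleftrightarrow>
     (\<exists>U\<subseteq>\<Omega>. open U \<and> connected U \<and> inj_on F U \<and> F ` U = ball c r)"

definition univalence_fun :: "nat \<Rightarrow> (nat \<Rightarrow> real) \<Rightarrow> real \<Rightarrow> real" where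
  "univalence_fun m M r =
     1 - (M 0 - 1 / M 0) * ((2 - r) * r / (1 - r)\<^sup>2)
       - (\<Sum>k\<in>{1..<m}. r ^ k * (M k / (1 - r\<^sup>2)))
       - (\<Sum>k\<in>{1..<m}. real k * r ^ k * M k)"

definition univalence_root :: "nat \<Rightarrow> (nat \<Rightarrow> real) \<Rightarrow> real \<Rightarrow> bool" where
  "univalence_root m M r \<longleftrightarrow> 0 < r \<and> r < 1 \<and> univalence_fun m M r = 0"

definition schlicht_radius :: "nat \<Rightarrow> (nat \<Rightarrow> real) \<Rightarrow> real \<Rightarrow> real" where
  "schlicht_radius m M r =
     r - (M 0 - 1 / M 0) * (r\<^sup>2 / (1 - r)) - (\<Sum>k\<in>{1..<m}. M k * r ^ k)"

end

theory Submission
  imports Defs "HOL-Real_Asymp.Real_Asymp"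
begin

text \<open>\<open>F - id\<close> is Lipschitz on the disk of radius \<open>r\<close> with constant \<open>1 - univalence_fun m M r\<close>, so \<open>F\<close> is
  injective as long as this constant stays below \<open>1\<close>. The contribution of \<open>f\<^sub>0\<close> comes from the
  sharp coefficient bound \<open>\<bar>a\<^sub>n\<bar> \<le> M\<^sub>0 - 1 / M\<^sub>0\<close> for \<open>n \<ge> 2\<close>, the others from Schwarz and Schwarz--Pick.
  Dividing the constant by \<open>r\<close> leaves an increasing function of \<open>r\<close>, which gives uniqueness of the root
  and strictness below it. On the circle of radius \<open>r\<^sub>2\<close> one has \<open>\<bar>F\<bar> \<ge> r\<^sub>3\<close>, so by invariance of
  domain \<open>F(U) \<inter> V\<close> is open and closed in \<open>V\<close>, for \<open>U\<close>, \<open>V\<close> the open disks of radius \<open>r\<^sub>2\<close>, \<open>r\<^sub>3\<close>.\<close>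

section \<open>Taylor coefficients of bounded holomorphic functions\<close>

text \<open>About the origin the velocity of the circle is \<open>2 * pi * \<i>\<close> times the
  point itself, which turns contour integrals into means over \<open>t\<close>.\<close>

lemma has_contour_integral_circlepath_0:
  "(g has_contour_integral I) (circlepath 0 r) \<longleftrightarrow>
   ((\<lambda>t. g (circlepath 0 r t) * (2 * pi * \<i> * circlepath 0 r t)) has_integral I) {0..1}"
  unfolding has_contour_integral vector_derivative_circlepath
  by (simp add: circlepath mult_ac)

lemma norm_circlepath_0 [simp]: "r > 0 \<Longrightarrow> norm (circlepath 0 r t) = r"
  by (simp add: circlepath norm_mult)

text \<open>Expanding the square leaves the cross term \<open>2 * Re (s * u ^ n)\<close>. Its mean
  is zero, because \<open>s * u ^ n\<close> averages to its value at the centre, which vanishes for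
  \<open>n \<ge> 1\<close>.\<close>

lemma mean_norm_sq_one_plus:
  assumes "n \<ge> 1" "0 < r"
  shows "((\<lambda>t. (norm (1 + s * circlepath 0 r t ^ n))\<^sup>2) has_integral (1 + (norm s * r ^ n)\<^sup>2)) {0..1}"
proof -
  have "((\<lambda>u. s * u ^ n / (u - 0)) has_contour_integral (2 * of_real pi * \<i> * (s * 0 ^ n))) (circlepath 0 r)"
    using assms by (intro Cauchy_integral_circlepath_simple) (auto intro!: holomorphic_intros)
  moreover have "circlepath 0 r t \<noteq> 0" for t
    by (metis norm_circlepath_0[OF \<open>0 < r\<close>] \<open>0 < r\<close> norm_zero less_irrefl)
  ultimately have "((\<lambda>t. (2 * pi * \<i>) * (s * circlepath 0 r t ^ n)) has_integral 0) {0..1}"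
    using assms by (simp add: has_contour_integral_circlepath_0 power_0_left mult_ac)
  from has_integral_mult_right[OF this, of "1 / (2 * pi * \<i>)"]
  have "((\<lambda>t. s * circlepath 0 r t ^ n) has_integral 0) {0..1}"
    by simp
  from has_integral_linear[OF this bounded_linear_Re]
  have Re: "((\<lambda>t. Re (s * circlepath 0 r t ^ n)) has_integral 0) {0..1}"
    by (simp add: o_def)
  have "((\<lambda>t. (1 + (norm s * r ^ n)\<^sup>2) + 2 * Re (s * circlepath 0 r t ^ n))
      has_integral ((1 - 0) *\<^sub>R (1 + (norm s * r ^ n)\<^sup>2) + 2 * 0)) {0..1}"
    using has_integral_const_real[of "1 + (norm s * r ^ n)\<^sup>2" 0 1]
    by (intro has_integral_add has_integral_mult_right Re) auto
  moreover have "(norm (1 + w))\<^sup>2 = 1 + (norm w)\<^sup>2 + 2 * Re w" for w :: complex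
    by (simp only: cmod_power2) (simp add: power2_eq_square algebra_simps)
  ultimately show ?thesis
    using assms by (simp add: norm_mult norm_power)
qed

text \<open>Cauchy's inequality on the circle of radius \<open>r < 1\<close> gives
  \<open>B / r\<close>; then \<open>r\<close> tends to \<open>1\<close>.\<close>

lemma norm_deriv_0_le:
  assumes "f holomorphic_on ball 0 1" "\<And>z. z \<in> ball 0 1 \<Longrightarrow> norm (f z) \<le> B"
  shows "norm (deriv f 0) \<le> B"
proof (rule field_le_mult_one_interval)
  fix r :: real assume r: "0 < r" "r < 1"
  have "norm ((deriv ^^ 1) f 0) \<le> fact 1 * B / r ^ 1"
  proof (rule Cauchy_inequality)
    show "f holomorphic_on ball 0 r"
      using assms(1) by (rule holomorphic_on_subset) (use r in auto)
    show "continuous_on (cball 0 r) f"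
      by (rule holomorphic_on_imp_continuous_on, rule holomorphic_on_subset[OF assms(1)]) (use r in auto)
  qed (use r assms(2) in auto)
  thus "r * norm (deriv f 0) \<le> B"
    using r by (simp add: field_simps)
qed

text \<open>Pairing \<open>f\<close> with the nonnegative kernel \<open>\<bar>1 + s z\<^sup>n\<bar>\<^sup>2\<close> on circles: its mean is
  \<open>1 + \<bar>s\<bar>\<^sup>2\<close> on the unit circle, and \<open>f(z) (1 + s z\<^sup>n)\<^sup>2 / z\<^bsup>n+2\<^esup>\<close> has residue
  \<open>a\<^bsub>n+1\<^esub> + 2 s a\<^sub>1\<close>.\<close>

lemma norm_coeff_combination_le:
  assumes holf: "f holomorphic_on ball 0 1" and B: "\<And>z. z \<in> ball 0 1 \<Longrightarrow> norm (f z) \<le> B"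
    and f0: "f 0 = 0" and n: "n \<ge> 1"
  shows "norm ((deriv ^^ Suc n) f 0 / fact (Suc n) + 2 * s * deriv f 0) \<le> B * (1 + (norm s)\<^sup>2)"
    (is "norm ?c \<le> _")
proof -
  have B0: "B \<ge> 0"
    using B[of 0] norm_ge_zero[of "f 0"] by (auto simp del: norm_ge_zero)
  have bound: "r ^ Suc n * norm ?c \<le> B * (1 + (norm s)\<^sup>2)" if r: "0 < r" "r < 1" for r
  proof -
    let ?\<gamma> = "circlepath 0 r :: real \<Rightarrow> complex"
    have hol: "f holomorphic_on cball 0 r"
      by (rule holomorphic_on_subset[OF holf]) (use r in auto)
    have holb: "f holomorphic_on ball 0 r"
      by (rule holomorphic_on_subset[OF holf]) (use r in auto)
    have cont: "continuous_on (cball 0 r) f"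
      using hol by (rule holomorphic_on_imp_continuous_on)
    note C = Cauchy_has_contour_integral_higher_derivative_circlepath[OF cont holb, of 0]
    have 1: "((\<lambda>u. f u / (u - 0) ^ Suc (Suc n)) has_contour_integral
        (2 * pi * \<i>) / fact (Suc n) * (deriv ^^ Suc n) f 0) ?\<gamma>"
      using r by (intro C) auto
    have "((\<lambda>u. f u / (u - 0) ^ Suc 1) has_contour_integral
        (2 * pi * \<i>) / fact 1 * (deriv ^^ 1) f 0) ?\<gamma>"
      using r by (intro C) auto
    from has_contour_integral_lmul[OF this, of "2 * s"]
    have 2: "((\<lambda>u. 2 * s * (f u / (u - 0) ^ Suc 1)) has_contour_integral
        2 * s * ((2 * pi * \<i>) * deriv f 0)) ?\<gamma>"
      by simp
    \<comment> \<open>The third term of the expanded square carries \<open>u\<close> to the power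
      \<open>n - 2\<close>, negative for \<open>n = 1\<close>; hence the form
      \<open>u ^ (n - 1) / u\<close>. Its integral vanishes because \<open>f 0 = 0\<close>.\<close>
    have 3: "((\<lambda>u. s\<^sup>2 * f u * u ^ (n - 1) / (u - 0)) has_contour_integral
        2 * of_real pi * \<i> * (s\<^sup>2 * f 0 * 0 ^ (n - 1))) ?\<gamma>"
      using r hol by (intro Cauchy_integral_circlepath_simple) (auto intro!: holomorphic_intros)
    have "((\<lambda>u. f u / (u - 0) ^ Suc (Suc n) + 2 * s * (f u / (u - 0) ^ Suc 1)
        + s\<^sup>2 * f u * u ^ (n - 1) / (u - 0)) has_contour_integral (2 * pi * \<i> * ?c)) ?\<gamma>"
      using has_contour_integral_add[OF has_contour_integral_add[OF 1 2] 3] f0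
      by (simp add: algebra_simps del: fact_Suc funpow.simps)
    hence "((\<lambda>u. f u * (1 + s * u ^ n)\<^sup>2 / u ^ Suc (Suc n)) has_contour_integral (2 * pi * \<i> * ?c)) ?\<gamma>"
    proof (rule has_contour_integral_eq)
      fix u assume "u \<in> path_image ?\<gamma>"
      hence "u \<noteq> 0"
        using r by auto
      moreover obtain k where "n = Suc k"
        using n by (cases n) auto
      ultimately show "f u / (u - 0) ^ Suc (Suc n) + 2 * s * (f u / (u - 0) ^ Suc 1)
          + s\<^sup>2 * f u * u ^ (n - 1) / (u - 0) = f u * (1 + s * u ^ n)\<^sup>2 / u ^ Suc (Suc n)"
        by (simp add: field_simps power2_eq_square)
    qed
    hence I1: "((\<lambda>t. f (?\<gamma> t) * (1 + s * ?\<gamma> t ^ n)\<^sup>2 / ?\<gamma> t ^ Suc (Suc n) * (2 * pi * \<i> * ?\<gamma> t))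
        has_integral (2 * pi * \<i> * ?c)) {0..1}"
      by (simp only: has_contour_integral_circlepath_0)
    have I2: "((\<lambda>t. (2 * pi * B / r ^ Suc n) * (norm (1 + s * ?\<gamma> t ^ n))\<^sup>2)
        has_integral (2 * pi * B / r ^ Suc n) * (1 + (norm s * r ^ n)\<^sup>2)) {0..1}"
      using n r by (intro has_integral_mult_right mean_norm_sq_one_plus) auto
    \<comment> \<open>The kernel is the modulus of the squared factor, so
      \<open>norm (f u) \<le> B\<close> lets the two integrands be compared pointwise.\<close>
    have "norm (2 * pi * \<i> * ?c) \<le> ((2 * pi * B / r ^ Suc n) * (1 + (norm s * r ^ n)\<^sup>2)) \<bullet> 1"
    proof (rule has_integral_norm_bound_integral_component[OF I1 I2])
      fix t :: real
      have "norm (f (?\<gamma> t)) * ((norm (1 + s * ?\<gamma> t ^ n))\<^sup>2 * (2 * pi)) / r ^ Suc n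
          \<le> B * ((norm (1 + s * ?\<gamma> t ^ n))\<^sup>2 * (2 * pi)) / r ^ Suc n"
        using r by (intro divide_right_mono mult_right_mono B) auto
      thus "norm (f (?\<gamma> t) * (1 + s * ?\<gamma> t ^ n)\<^sup>2 / ?\<gamma> t ^ Suc (Suc n) * (2 * pi * \<i> * ?\<gamma> t))
          \<le> ((2 * pi * B / r ^ Suc n) * (norm (1 + s * ?\<gamma> t ^ n))\<^sup>2) \<bullet> 1"
        using r B0 by (simp add: norm_mult norm_divide norm_power field_simps)
    qed
    hence "2 * pi * norm ?c \<le> 2 * pi * (B / r ^ Suc n * (1 + (norm s * r ^ n)\<^sup>2))"
      by (simp add: norm_mult del: fact_Suc funpow.simps power_Suc)
    hence "norm ?c \<le> B / r ^ Suc n * (1 + (norm s * r ^ n)\<^sup>2)"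
      by (rule mult_left_le_imp_le) simp
    hence "r ^ Suc n * norm ?c \<le> r ^ Suc n * (B / r ^ Suc n * (1 + (norm s * r ^ n)\<^sup>2))"
      using r by (intro mult_left_mono) auto
    hence "r ^ Suc n * norm ?c \<le> B * (1 + (norm s * r ^ n)\<^sup>2)"
      using r by simp
    also have "\<dots> \<le> B * (1 + (norm s)\<^sup>2)"
      using B0 r by (intro mult_left_mono add_left_mono power_mono mult_left_le) (auto intro: power_le_one)
    finally show ?thesis .
  qed
  \<comment> \<open>The bound on \<open>f\<close> is available on the open disk only, so the unit
    circle is reached as a limit of smaller circles.\<close>
  have lim: "((\<lambda>r. r ^ Suc n * norm ?c) \<longlongrightarrow> 1 ^ Suc n * norm ?c) (at_left (1::real))"
    by (intro tendsto_intros)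
  have "eventually (\<lambda>r. r ^ Suc n * norm ?c \<le> B * (1 + (norm s)\<^sup>2)) (at_left (1::real))"
  proof (rule eventually_mono)
    show "eventually (\<lambda>r. r \<in> {0<..<1}) (at_left (1::real))"
      by (rule eventually_at_left_real) simp
    show "r ^ Suc n * norm ?c \<le> B * (1 + (norm s)\<^sup>2)" if "r \<in> {0<..<1}" for r
      by (rule bound) (use that in simp_all)
  qed
  from tendsto_upperbound[OF lim this trivial_limit_at_left_real]
  show ?thesis
    by (simp only: power_one mult_1)
qed

text \<open>Take \<open>s = u / B\<close> with \<open>u\<close> the phase of the coefficient
  \<open>a\<close>: both terms on the left then align to \<open>norm a + 2 / B\<close>, and the
  right side is \<open>B + 1 / B\<close>. The modulus \<open>1 / B\<close> is the \<open>x\<close>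
  that minimises \<open>B * (1 + x\<^sup>2) - 2 * x\<close>.\<close>

lemma norm_coeff_le:
  assumes holf: "f holomorphic_on ball 0 1" and B: "\<And>z. z \<in> ball 0 1 \<Longrightarrow> norm (f z) \<le> B"
    and f0: "f 0 = 0" and f1: "deriv f 0 = 1" and n: "n \<ge> 1"
  shows "norm ((deriv ^^ Suc n) f 0 / fact (Suc n)) \<le> B - 1 / B" (is "norm ?a \<le> _")
proof -
  have B1: "B \<ge> 1"
    using norm_deriv_0_le[OF holf B] f1 by simp
  have "\<exists>u::complex. norm u = 1 \<and> a = norm a * u" for a :: complex
    by (rule exI[of _ "if a = 0 then 1 else a / norm a"]) (auto simp: norm_divide)
  then obtain u :: complex where u: "norm u = 1" "?a = norm ?a * u"
    by blast
  have "norm (?a + 2 * (u / B) * deriv f 0) \<le> B * (1 + (norm (u / B))\<^sup>2)"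
    by (rule norm_coeff_combination_le[OF holf B f0 n])
  moreover have "?a + 2 * (u / B) * deriv f 0 = of_real (norm ?a + 2 / B) * u"
    using f1 by (subst (1) u(2)) (simp add: algebra_simps)
  moreover have "norm ?a + 2 / B \<ge> 0"
    using B1 by simp
  ultimately have "norm ?a + 2 / B \<le> B * (1 + (1 / B)\<^sup>2)"
    using u(1) B1 by (simp add: norm_mult norm_divide del: fact_Suc funpow.simps of_real_add)
  also have "\<dots> = B + 1 / B"
    using B1 by (simp add: field_simps power2_eq_square)
  finally show ?thesis
    by simp
qed

section \<open>Estimates of Schwarz and Schwarz-Pick type\<close>

text \<open>Precomposing with the disk automorphism that sends \<open>0\<close> to \<open>z\<close>
  reduces this to the bound at the origin; the chain rule contributes the factor
  \<open>1 - (norm z)\<^sup>2\<close>.\<close>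

lemma norm_deriv_le:
  assumes holf: "f holomorphic_on ball 0 1" and B: "\<And>z. z \<in> ball 0 1 \<Longrightarrow> norm (f z) \<le> B"
    and z: "norm z < 1"
  shows "norm (deriv f z) \<le> B / (1 - (norm z)\<^sup>2)"
proof -
  let ?\<phi> = "Moebius_function 0 (- z)"
  have ball: "?\<phi> w \<in> ball 0 1" if "w \<in> ball 0 1" for w
    using Moebius_function_norm_lt_1[of "- z" w 0] that z by simp
  have hol\<phi>: "?\<phi> holomorphic_on ball 0 1"
    using z by (intro Moebius_function_holomorphic) auto
  have holc: "(f \<circ> ?\<phi>) holomorphic_on ball 0 1"
    by (rule holomorphic_on_compose_gen[OF hol\<phi> holf]) (use ball in auto)
  have "norm (deriv (f \<circ> ?\<phi>) 0) \<le> B"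
    by (rule norm_deriv_0_le[OF holc]) (use B ball in auto)
  moreover have "(?\<phi> has_field_derivative (1 - z * cnj z)) (at 0)"
    unfolding Moebius_function_simple by (auto intro!: derivative_eq_intros)
  moreover have "(f has_field_derivative deriv f z) (at (?\<phi> 0))"
    using holomorphic_derivI[OF holf, of z] z by (simp add: Moebius_function_of_zero)
  ultimately have "norm (deriv f z * (1 - z * cnj z)) \<le> B"
    using DERIV_imp_deriv[OF DERIV_chain[of f _ ?\<phi> 0]] by fastforce
  moreover have "norm (1 - z * cnj z) = 1 - (norm z)\<^sup>2"
  proof -
    have "1 - z * cnj z = of_real (1 - (norm z)\<^sup>2)"
      by (simp add: complex_norm_square[symmetric] del: of_real_power)
    thus ?thesis
      using z by (simp only: norm_of_real) (simp add: power_le_one abs_square_le_1)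
  qed
  ultimately have "norm (deriv f z) * (1 - (norm z)\<^sup>2) \<le> B"
    by (simp only: norm_mult)
  moreover have "1 - (norm z)\<^sup>2 > 0"
    using z by (simp add: abs_square_less_1)
  ultimately show ?thesis
    by (simp only: pos_le_divide_eq)
qed

text \<open>Schwarz's lemma asks for a strict bound by \<open>1\<close>, so it is applied to
  \<open>f / C\<close> with \<open>C > B\<close>, and then \<open>C\<close> tends to
  \<open>B\<close>. This also covers \<open>B = 0\<close>.\<close>

lemma norm_le_mult_norm:
  assumes holf: "f holomorphic_on ball 0 1" and B: "\<And>z. z \<in> ball 0 1 \<Longrightarrow> norm (f z) \<le> B"
    and f0: "f 0 = 0" and z: "norm z < 1"
  shows "norm (f z) \<le> B * norm z"
proof -
  have B0: "B \<ge> 0"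
    using B[of 0] norm_ge_zero[of "f 0"] by (auto simp del: norm_ge_zero)
  have "norm (f z) \<le> C * norm z" if C: "C > B" for C
  proof -
    have "norm (f z / C) \<le> norm z"
    proof (rule Schwarz_Lemma)
      show "(\<lambda>z. f z / C) holomorphic_on ball 0 1"
        using C B0 by (intro holomorphic_intros holf) auto
      show "norm (f w / C) < 1" if "norm w < 1" for w
        using B[of w] that C B0 by (simp add: norm_divide field_simps)
    qed (use f0 z in auto)
    thus ?thesis
      using C B0 by (simp add: norm_divide field_simps)
  qed
  moreover have "((\<lambda>C. C * norm z) \<longlongrightarrow> B * norm z) (at_right B)"
    by (intro tendsto_intros)
  ultimately show ?thesis
    by (intro tendsto_lowerbound[of "\<lambda>C. C * norm z" _ "at_right B"])
       (auto simp: eventually_at_filter)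
qed

section \<open>Distance of the analytic component from the identity\<close>

text \<open>Removing the constant term \<open>1\<close> from the series of \<open>deriv f\<close>
  leaves the coefficients of \<open>f\<close> from index \<open>2\<close> on, each at most
  \<open>B - 1 / B\<close>. What remains is the differentiated geometric series without its first
  term.\<close>

lemma norm_deriv_minus_one_le:
  assumes holf: "f holomorphic_on ball 0 1" and B: "\<And>z. z \<in> ball 0 1 \<Longrightarrow> norm (f z) \<le> B"
    and f0: "f 0 = 0" and f1: "deriv f 0 = 1" and z: "norm z \<le> r" and r: "r < 1"
  shows "norm (deriv f z - 1) \<le> (B - 1 / B) * ((2 - r) * r / (1 - r)\<^sup>2)"
proof -
  let ?c = "B - 1 / B"
  let ?b = "\<lambda>n. (deriv ^^ n) (deriv f) 0 / fact n * (z - 0) ^ n"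
  have r0: "r \<ge> 0"
    using z norm_ge_zero order_trans by blast
  have "?b sums deriv f z"
    using z r by (intro holomorphic_power_series[of _ _ 1] holomorphic_deriv holf) auto
  hence 1: "(\<lambda>n. ?b (Suc n)) sums (deriv f z - 1)"
    using f1 by (subst sums_Suc_iff) simp
  have "(\<lambda>n. real (Suc n) * r ^ n) sums (1 / (1 - r)\<^sup>2)"
    using r r0 by (intro geometric_deriv_sums) auto
  hence "(\<lambda>n. real (Suc (Suc n)) * r ^ Suc n) sums (1 / (1 - r)\<^sup>2 - 1)"
    by (subst sums_Suc_iff) simp
  from sums_mult[OF this, of ?c]
  have 2: "(\<lambda>n. ?c * (real (Suc (Suc n)) * r ^ Suc n)) sums (?c * (1 / (1 - r)\<^sup>2 - 1))" .
  have "norm (?b (Suc n)) \<le> ?c * (real (Suc (Suc n)) * r ^ Suc n)" for n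
  proof -
    let ?a = "(deriv ^^ Suc (Suc n)) f 0 / fact (Suc (Suc n))"
    have a: "norm ?a \<le> ?c"
      by (rule norm_coeff_le[OF holf B f0 f1]) auto
    have c: "0 \<le> ?c"
      using a norm_ge_zero order_trans by blast
    \<comment> \<open>Coefficient \<open>n + 1\<close> of \<open>deriv f\<close> is
      \<open>n + 2\<close> times coefficient \<open>n + 2\<close> of \<open>f\<close>.\<close>
    have "?b (Suc n) = ?a * (of_nat (Suc (Suc n)) * z ^ Suc n)"
      using fact_Suc[of "Suc n", where 'a = complex]
      by (simp add: funpow_Suc_right field_simps del: fact_Suc funpow.simps of_nat_Suc)
    hence "norm (?b (Suc n)) = norm ?a * (real (Suc (Suc n)) * norm z ^ Suc n)"
      by (simp only: norm_mult norm_power norm_of_nat)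
    also have "\<dots> \<le> ?c * (real (Suc (Suc n)) * r ^ Suc n)"
      using a c z r0 by (intro mult_mono power_mono) simp_all
    finally show ?thesis .
  qed
  hence "norm (deriv f z - 1) \<le> ?c * (1 / (1 - r)\<^sup>2 - 1)"
    by (rule norm_sums_le[OF 1 2])
  also have "1 / (1 - r)\<^sup>2 - 1 = (2 - r) * r / (1 - r)\<^sup>2"
    using r by (simp add: divide_simps) (simp add: power2_eq_square algebra_simps)
  finally show ?thesis .
qed

text \<open>The first two terms of the series of \<open>f\<close> are \<open>0\<close> and
  \<open>z\<close>; the tail is dominated by a geometric series starting at
  \<open>r\<^sup>2\<close>.\<close>

lemma norm_minus_id_le:
  assumes holf: "f holomorphic_on ball 0 1" and B: "\<And>z. z \<in> ball 0 1 \<Longrightarrow> norm (f z) \<le> B"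
    and f0: "f 0 = 0" and f1: "deriv f 0 = 1" and z: "norm z \<le> r" and r: "r < 1"
  shows "norm (f z - z) \<le> (B - 1 / B) * (r\<^sup>2 / (1 - r))"
proof -
  let ?c = "B - 1 / B"
  let ?b = "\<lambda>n. (deriv ^^ n) f 0 / fact n * (z - 0) ^ n"
  have r0: "r \<ge> 0"
    using z norm_ge_zero order_trans by blast
  have "?b sums f z"
    using z r by (intro holomorphic_power_series[of _ _ 1] holf) auto
  hence "(\<lambda>n. ?b (Suc n)) sums f z"
    using f0 by (subst sums_Suc_iff) simp
  hence 1: "(\<lambda>n. ?b (Suc (Suc n))) sums (f z - z)"
    using f1 by (subst sums_Suc_iff) simp
  have 2: "(\<lambda>n. (?c * r\<^sup>2) * r ^ n) sums ((?c * r\<^sup>2) * (1 / (1 - r)))"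
    using r r0 by (intro sums_mult geometric_sums) auto
  have "norm (?b (Suc (Suc n))) \<le> ?c * r\<^sup>2 * r ^ n" for n
  proof -
    let ?a = "(deriv ^^ Suc (Suc n)) f 0 / fact (Suc (Suc n))"
    have a: "norm ?a \<le> ?c"
      by (rule norm_coeff_le[OF holf B f0 f1]) auto
    have c: "0 \<le> ?c"
      using a norm_ge_zero order_trans by blast
    have "norm (?b (Suc (Suc n))) = norm ?a * norm z ^ Suc (Suc n)"
      by (simp only: norm_mult norm_power diff_0_right)
    also have "\<dots> \<le> ?c * r ^ Suc (Suc n)"
      using a c z r0 by (intro mult_mono power_mono) simp_all
    finally show ?thesis
      by (simp only: power2_eq_square power_Suc mult_ac)
  qed
  hence "norm (f z - z) \<le> (?c * r\<^sup>2) * (1 / (1 - r))"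
    by (rule norm_sums_le[OF 1 2])
  thus ?thesis
    by simp
qed

section \<open>Components with a conjugate power\<close>

text \<open>This is the mean value inequality on a convex disk. For \<open>k = 0\<close> the
  truncated exponent \<open>k - 1\<close> is harmless, being multiplied by \<open>0\<close>.\<close>

lemma norm_power_diff_le:
  fixes z w :: complex
  assumes "norm z \<le> r" "norm w \<le> r"
  shows "norm (z ^ k - w ^ k) \<le> real k * r ^ (k - 1) * norm (z - w)"
proof (rule field_differentiable_bound[of "cball 0 r"])
  show "((\<lambda>z. z ^ k) has_field_derivative (of_nat k * u ^ (k - 1))) (at u within cball 0 r)" for u :: complex
    by (auto intro!: derivative_eq_intros)
  show "norm (of_nat k * u ^ (k - 1)) \<le> real k * r ^ (k - 1)" if "u \<in> cball 0 r" for u :: complex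
    using that by (auto simp: norm_mult norm_power intro!: mult_left_mono power_mono)
qed (use assms in auto)

text \<open>In the product rule for differences, the increment of \<open>f\<close> is controlled by
  Schwarz-Pick and its size by Schwarz. The factor \<open>r\<close> from Schwarz raises
  \<open>r ^ (k - 1)\<close> to \<open>r ^ k\<close>.\<close>

lemma norm_cnj_power_mult_diff_le:
  assumes holf: "f holomorphic_on ball 0 1" and B: "\<And>z. z \<in> ball 0 1 \<Longrightarrow> norm (f z) \<le> B"
    and f0: "f 0 = 0" and k: "k \<ge> 1" and z: "norm z \<le> r" and w: "norm w \<le> r" and r: "r < 1"
  shows "norm (cnj z ^ k * f z - cnj w ^ k * f w)
    \<le> (r ^ k * (B / (1 - r\<^sup>2)) + real k * r ^ k * B) * norm (z - w)"
proof -
  have r0: "r \<ge> 0"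
    using z norm_ge_zero order_trans by blast
  have r2: "r\<^sup>2 < 1"
    using r r0 by (simp add: abs_square_less_1)
  have B0: "B \<ge> 0"
    using B[of 0] norm_ge_zero[of "f 0"] by (auto simp del: norm_ge_zero)
  have f: "norm (f z - f w) \<le> B / (1 - r\<^sup>2) * norm (z - w)"
  proof (rule field_differentiable_bound[of "cball 0 r"])
    fix u :: complex assume u: "u \<in> cball 0 r"
    show "(f has_field_derivative deriv f u) (at u within cball 0 r)"
      using u r by (intro has_field_derivative_at_within[OF holomorphic_derivI[OF holf]]) auto
    have "norm (deriv f u) \<le> B / (1 - (norm u)\<^sup>2)"
      using u r by (intro norm_deriv_le holf B) auto
    also have "\<dots> \<le> B / (1 - r\<^sup>2)"
      using u r2 B0 by (intro divide_left_mono mult_pos_pos) (auto intro: power_mono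
          order.strict_trans1[OF power_mono[of "norm u" r 2]])
    finally show "norm (deriv f u) \<le> B / (1 - r\<^sup>2)" .
  qed (use z w in auto)
  \<comment> \<open>Conjugation is moved outside the difference of powers, where it preserves the
    norm, so that only analytic functions are differentiated.\<close>
  have "cnj z ^ k * f z - cnj w ^ k * f w
      = cnj z ^ k * (f z - f w) + cnj (z ^ k - w ^ k) * f w"
    by (simp add: algebra_simps)
  hence "norm (cnj z ^ k * f z - cnj w ^ k * f w)
      \<le> norm (cnj z ^ k) * norm (f z - f w) + norm (cnj (z ^ k - w ^ k)) * norm (f w)"
    by (metis norm_triangle_ineq norm_mult)
  also have "norm (cnj z ^ k) * norm (f z - f w) \<le> r ^ k * (B / (1 - r\<^sup>2) * norm (z - w))"
    using z r0 by (intro mult_mono f) (auto simp: norm_power intro: power_mono)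
  also have "norm (cnj (z ^ k - w ^ k)) * norm (f w) \<le> (real k * r ^ (k - 1) * norm (z - w)) * (B * r)"
  proof (intro mult_mono)
    show "norm (cnj (z ^ k - w ^ k)) \<le> real k * r ^ (k - 1) * norm (z - w)"
      by (subst complex_mod_cnj) (rule norm_power_diff_le[OF z w])
    have "norm (f w) \<le> B * norm w"
      using w r by (intro norm_le_mult_norm holf B f0) auto
    also have "\<dots> \<le> B * r"
      using w B0 by (intro mult_left_mono)
    finally show "norm (f w) \<le> B * r" .
  qed (use r0 in auto)
  also have "r ^ k * (B / (1 - r\<^sup>2) * norm (z - w)) + (real k * r ^ (k - 1) * norm (z - w)) * (B * r)
      = (r ^ k * (B / (1 - r\<^sup>2)) + real k * r ^ k * B) * norm (z - w)"
    using k by (cases k) (auto simp: algebra_simps)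
  finally show ?thesis
    by simp
qed

section \<open>The Wirtinger derivative at the origin\<close>

text \<open>Both factors vanish at \<open>0\<close>, so both terms of the real product rule do. The
  zero map is complex linear, which gives complex differentiability at this point although the
  product need not be holomorphic.\<close>

lemma has_field_derivative_cnj_power_mult_0:
  assumes "f holomorphic_on ball 0 1" "f 0 = 0" "k \<ge> 1"
  shows "((\<lambda>z. cnj z ^ k * f z) has_field_derivative 0) (at 0)"
proof -
  have "(f has_derivative (\<lambda>h. deriv f 0 * h)) (at 0)"
    using holomorphic_derivI[OF assms(1), of 0] by (simp add: has_field_derivative_def)
  moreover have "((\<lambda>z. cnj z ^ k) has_derivative (\<lambda>h. of_nat k * cnj h * cnj 0 ^ (k - 1))) (at 0)"
    by (rule has_derivative_power) (rule has_derivative_cnj has_derivative_ident)+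
  ultimately show ?thesis
    using has_derivative_mult[of "\<lambda>z. cnj z ^ k" _ 0 UNIV f] assms
    by (simp add: has_field_derivative_def power_0_left lambda_zero)
qed

text \<open>The derivative along direction \<open>v\<close> is \<open>v * a\<close>; the directions
  \<open>1\<close> and \<open>\<i>\<close> combine to
  \<open>(a - \<i> * (\<i> * a)) / 2 = a\<close>.\<close>

lemma wirtinger_z_eq_field_derivative:
  assumes "(F has_field_derivative a) (at z)"
  shows "wirtinger_z F z = a"
proof -
  have *: "vector_derivative (\<lambda>t::real. F (z + v * of_real t)) (at 0) = v * a" for v
  proof (rule vector_derivative_at)
    have "((\<lambda>t::real. z + v * of_real t) has_vector_derivative v) (at 0)"
      by (auto intro!: derivative_eq_intros simp: has_vector_derivative_def scaleR_conv_of_real)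
    from field_vector_diff_chain_at[OF this, of F a]
    show "((\<lambda>t::real. F (z + v * of_real t)) has_vector_derivative v * a) (at 0)"
      using assms by (simp add: o_def)
  qed
  show ?thesis
    using *[of 1] *[of \<i>] by (simp add: wirtinger_z_def)
qed

section \<open>From a boundary estimate to a schlicht disk\<close>

lemma contains_schlicht_diskI:
  assumes cont: "continuous_on (cball 0 s) F" and inj: "inj_on F (ball 0 s)" and s: "s > 0"
    and F0: "F 0 = 0" and sphere: "\<And>z. norm z = s \<Longrightarrow> R \<le> norm (F z)"
  shows "contains_schlicht_disk F (ball 0 s) 0 R"
proof (cases "R > 0")
  case False
  thus ?thesis
    unfolding contains_schlicht_disk_def by (intro exI[of _ "{}"]) (simp add: ball_empty)
next
  case True
  have contb: "continuous_on (ball 0 s) F"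
    using cont by (rule continuous_on_subset) auto
  have openF: "open (F ` ball 0 s)"
    by (rule invariance_of_domain[OF contb _ inj]) auto
  \<comment> \<open>The boundary circle has no values inside \<open>ball 0 R\<close>, so the closed
    disk may replace the open one; its compact image yields relative closedness.\<close>
  have "F ` ball 0 s \<inter> ball 0 R = F ` cball 0 s \<inter> ball 0 R"
  proof -
    have "z \<in> ball 0 s" if "z \<in> cball 0 s" "F z \<in> ball 0 R" for z
      using that sphere[of z] by fastforce
    thus ?thesis
      by auto
  qed
  moreover have "closed (F ` cball 0 s)"
    by (intro compact_imp_closed compact_continuous_image cont compact_cball)
  ultimately have "closedin (top_of_set (ball 0 R)) (F ` ball 0 s \<inter> ball 0 R)"
    using closedin_closed_Int[of "F ` cball 0 s" "ball 0 R"] by (simp only: Int_commute)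
  moreover have "openin (top_of_set (ball 0 R)) (F ` ball 0 s \<inter> ball 0 R)"
    using openin_open_Int[OF openF, of "ball 0 R"] by (simp only: Int_commute)
  moreover have "0 \<in> F ` ball 0 s \<inter> ball 0 R"
    using s True F0 by (auto intro!: image_eqI[of _ _ 0])
  ultimately have "F ` ball 0 s \<inter> ball 0 R = ball 0 R"
    using connected_clopen[of "ball 0 R :: complex set"] connected_ball by blast
  hence sub: "ball 0 R \<subseteq> F ` ball 0 s"
    by blast
  \<comment> \<open>The region sought is the image of \<open>ball 0 R\<close> under the inverse
    \<open>g\<close>: connected by continuity of \<open>g\<close>, and open by a second use of
    invariance of domain.\<close>
  obtain g where g: "homeomorphism (ball 0 s) (F ` ball 0 s) F g"
    using invariance_of_domain_homeomorphism[OF open_ball contb _ inj] by auto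
  have contg: "continuous_on (ball 0 R) g"
    by (rule continuous_on_subset[OF homeomorphism_cont2[OF g] sub])
  have Fg: "F (g w) = w" "g w \<in> ball 0 s" if "w \<in> ball 0 R" for w
    using homeomorphism_apply2[OF g subsetD[OF sub that]]
      imageI[OF subsetD[OF sub that], of g] homeomorphism_image2[OF g] by simp_all
  have "inj_on g (ball 0 R)"
    by (metis Fg(1) inj_onI)
  hence "open (g ` ball 0 R)"
    by (intro invariance_of_domain contg) auto
  moreover have "connected (g ` ball 0 R)"
    by (intro connected_continuous_image contg connected_ball)
  moreover have "g ` ball 0 R \<subseteq> ball 0 s"
    using Fg by blast
  moreover have "F ` g ` ball 0 R = ball 0 R"
    using Fg(1) by (simp add: image_image)
  ultimately show ?thesis
    unfolding contains_schlicht_disk_def using inj_on_subset[OF inj]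
    by (intro exI[of _ "g ` ball 0 R"]) simp
qed

section \<open>The equation for the radius of univalence\<close>

text \<open>Each summand of \<open>1 - univalence_fun m M r\<close> contains a factor
  \<open>r\<close>, and the remaining quotient is nondecreasing in \<open>r\<close>. The estimate is
  this monotonicity, taken summand by summand.\<close>

lemma one_minus_univalence_fun_le:
  assumes M0: "1 \<le> M 0" and Mk: "\<And>k. k \<in> {1..<m} \<Longrightarrow> 0 \<le> M k"
    and r: "0 < r" "r \<le> s" "s < 1"
  shows "1 - univalence_fun m M r \<le> r / s * (1 - univalence_fun m M s)"
proof -
  let ?c = "M 0 - 1 / M 0"
  have s: "s > 0"
    using r by simp
  have pow: "r ^ k \<le> r / s * s ^ k" if k: "k \<ge> 1" for k
  proof -
    obtain j where "k = Suc j"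
      using k by (cases k) auto
    thus ?thesis
      using r s by (auto intro!: mult_left_mono power_mono)
  qed
  have sq: "r\<^sup>2 \<le> s\<^sup>2" "r\<^sup>2 < 1" "s\<^sup>2 < 1"
    using r s by (auto intro: power_mono simp: abs_square_less_1)
  have "?c * ((2 - r) * r / (1 - r)\<^sup>2) \<le> r / s * (?c * ((2 - s) * s / (1 - s)\<^sup>2))"
  proof -
    have c: "?c \<ge> 0"
      using M0 by (simp add: field_simps mult_ge1_I)
    \<comment> \<open>The numerator \<open>2 - x\<close> decreases, so monotonicity is read off the
      partial fractions instead.\<close>
    have split: "(2 - x) / (1 - x)\<^sup>2 = 1 / (1 - x) + 1 / (1 - x)\<^sup>2" if "x < 1" for x :: real
      using that by (simp add: divide_simps) (simp add: power2_eq_square algebra_simps)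
    have "(2 - r) / (1 - r)\<^sup>2 \<le> (2 - s) / (1 - s)\<^sup>2"
      using r by (simp add: split) (intro add_mono divide_left_mono power_mono mult_pos_pos; simp)
    hence "(?c * r) * ((2 - r) / (1 - r)\<^sup>2) \<le> (?c * r) * ((2 - s) / (1 - s)\<^sup>2)"
      using c r by (intro mult_left_mono) auto
    thus ?thesis
      using s by (simp add: mult_ac)
  qed
  moreover have "(\<Sum>k\<in>{1..<m}. r ^ k * (M k / (1 - r\<^sup>2)))
      \<le> r / s * (\<Sum>k\<in>{1..<m}. s ^ k * (M k / (1 - s\<^sup>2)))"
    unfolding sum_distrib_left
  proof (rule sum_mono)
    fix k assume k: "k \<in> {1..<m}"
    have "r ^ k * (M k / (1 - r\<^sup>2)) \<le> (r / s * s ^ k) * (M k / (1 - s\<^sup>2))"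
      using k Mk[OF k] sq r s
      by (intro mult_mono pow divide_left_mono divide_nonneg_nonneg mult_pos_pos) auto
    thus "r ^ k * (M k / (1 - r\<^sup>2)) \<le> r / s * (s ^ k * (M k / (1 - s\<^sup>2)))"
      by (simp only: mult.assoc)
  qed
  moreover have "(\<Sum>k\<in>{1..<m}. real k * r ^ k * M k) \<le> r / s * (\<Sum>k\<in>{1..<m}. real k * s ^ k * M k)"
    unfolding sum_distrib_left
  proof (rule sum_mono)
    fix k assume k: "k \<in> {1..<m}"
    have "(real k * M k) * r ^ k \<le> (real k * M k) * (r / s * s ^ k)"
      using k Mk[OF k] by (intro mult_left_mono pow) auto
    thus "real k * r ^ k * M k \<le> r / s * (real k * s ^ k * M k)"
      by (simp only: mult_ac)
  qed
  ultimately show ?thesis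
    unfolding univalence_fun_def by (simp only: right_diff_distrib distrib_left)
qed

text \<open>At a root the Lipschitz constant equals \<open>1\<close>, so two roots
  \<open>r < s\<close> would give \<open>1 \<le> r / s\<close>.\<close>

lemma univalence_root_unique:
  assumes M0: "1 \<le> M 0" and Mk: "\<And>k. k \<in> {1..<m} \<Longrightarrow> 0 \<le> M k"
    and "univalence_root m M r" "univalence_root m M s"
  shows "r = s"
proof -
  have "\<not> r < s" if "univalence_root m M r" "univalence_root m M s" for r s
  proof
    assume "r < s"
    moreover have "1 \<le> r / s"
      using one_minus_univalence_fun_le[of M m r s, OF M0 Mk] that \<open>r < s\<close>
      by (simp add: univalence_root_def)
    ultimately show False
      using that by (simp add: univalence_root_def field_simps)
  qed
  thus ?thesis
    using assms by (metis linorder_neqE)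
qed

text \<open>The function is \<open>1\<close> at \<open>0\<close>, and some subtracted term blows up
  at \<open>1\<close>, so the intermediate value theorem applies. If \<open>M 0 = 1\<close> and all
  other \<open>M k\<close> vanish, the function is constantly \<open>1\<close> and has no root;
  \<open>nontrivial\<close> excludes this case.\<close>

lemma univalence_root_exists:
  assumes M0: "1 \<le> M 0" and Mk: "\<And>k. k \<in> {1..<m} \<Longrightarrow> 0 \<le> M k"
    and nontrivial: "M 0 \<noteq> 1 \<or> (\<exists>k\<in>{1..<m}. M k \<noteq> 0)"
  shows "\<exists>r. univalence_root m M r"
proof -
  let ?c = "M 0 - 1 / M 0"
  let ?A = "\<lambda>r. ?c * ((2 - r) * r / (1 - r)\<^sup>2)"
  let ?B = "\<lambda>r. \<Sum>k\<in>{1..<m}. r ^ k * (M k / (1 - r\<^sup>2))"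
  let ?C = "\<lambda>r. \<Sum>k\<in>{1..<m}. real k * r ^ k * M k"
  have c: "?c \<ge> 0"
    using M0 by (simp add: field_simps mult_ge1_I)
  have nonneg: "?A r \<ge> 0" "\<And>k. k \<in> {1..<m} \<Longrightarrow> r ^ k * (M k / (1 - r\<^sup>2)) \<ge> 0" "?C r \<ge> 0"
    if "0 < r" "r < 1" for r
    using that c Mk by (auto intro!: mult_nonneg_nonneg divide_nonneg_nonneg sum_nonneg simp: abs_square_le_1)
  have ev: "eventually (\<lambda>r. r \<in> {0<..<1}) (at_left (1::real))"
    by (rule eventually_at_left_real) simp
  \<comment> \<open>All subtracted terms are nonnegative, so a single one reaching \<open>1\<close>
    makes the function nonpositive.\<close>
  have "eventually (\<lambda>r. 1 \<le> ?A r \<or> 1 \<le> ?B r) (at_left 1)"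
    using nontrivial
  proof
    assume "M 0 \<noteq> 1"
    hence "M 0 > 1"
      using M0 by simp
    hence "?c > 0"
      by (simp add: field_simps less_1_mult)
    hence "filterlim ?A at_top (at_left 1)"
      by real_asymp
    thus ?thesis
      unfolding filterlim_at_top by (auto elim: eventually_mono)
  next
    assume "\<exists>k\<in>{1..<m}. M k \<noteq> 0"
    then obtain k where k: "k \<in> {1..<m}" "M k > 0"
      using Mk by (metis less_eq_real_def)
    have "filterlim (\<lambda>r. r ^ k * (M k / (1 - r\<^sup>2))) at_top (at_left 1)"
      using k(2) by real_asymp
    hence "eventually (\<lambda>r. 1 \<le> r ^ k * (M k / (1 - r\<^sup>2))) (at_left 1)"
      unfolding filterlim_at_top by auto
    with ev show ?thesis
    proof eventually_elim
      case (elim r)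
      have "r ^ k * (M k / (1 - r\<^sup>2)) \<le> ?B r"
        using elim k by (intro member_le_sum nonneg) auto
      thus ?case
        using elim by linarith
    qed
  qed
  with ev have "eventually (\<lambda>r. r \<in> {0<..<1} \<and> univalence_fun m M r \<le> 0) (at_left 1)"
  proof eventually_elim
    case (elim r)
    have "?B r \<ge> 0"
      using elim by (intro sum_nonneg nonneg) auto
    moreover have "0 < r" "r < 1"
      using elim by auto
    ultimately show ?case
      using elim nonneg(1,3)[of r] unfolding univalence_fun_def by (smt (verit))
  qed
  then obtain s where s: "0 < s" "s < 1" "univalence_fun m M s \<le> 0"
    using eventually_happens[of _ "at_left (1::real)"] by auto
  have u0: "univalence_fun m M 0 = 1"
    by (simp add: univalence_fun_def power_0_left)
  have "continuous_on {0..s} (univalence_fun m M)"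
  proof -
    have "1 - x \<noteq> 0" "1 - x\<^sup>2 \<noteq> 0" if "x \<in> {0..s}" for x
      using that s abs_square_less_1[of x] by auto
    thus ?thesis
      unfolding univalence_fun_def by (intro continuous_intros) auto
  qed
  then obtain r where r: "0 \<le> r" "r \<le> s" "univalence_fun m M r = 0"
    using IVT2'[of "univalence_fun m M" s 0 0] s u0 by auto
  moreover have "r \<noteq> 0"
    using r u0 by auto
  ultimately show ?thesis
    using s unfolding univalence_root_def by (intro exI[of _ r]) auto
qed

section \<open>Univalence and covering for the poly-analytic function\<close>

theorem theorem3p2:
  fixes m :: nat and M :: "nat \<Rightarrow> real"
    and f :: "nat \<Rightarrow> complex \<Rightarrow> complex" and F :: "complex \<Rightarrow> complex"
  assumes "1 \<le> m"
    and "\<And>k. k < m \<Longrightarrow> 0 \<le> M k"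
    and "polyanalytic_with (ball 0 1) m f F"
    and "wirtinger_z F 0 = 1"
    and "\<And>k. k < m \<Longrightarrow> f k 0 = 0"
    and "\<And>k z. k < m \<Longrightarrow> z \<in> ball 0 1 \<Longrightarrow> norm (f k z) \<le> M k"
  shows "1 \<le> M 0 \<and>
    (M 0 \<noteq> 1 \<or> (\<exists>k\<in>{1..<m}. M k \<noteq> 0) \<longrightarrow> (\<exists>!r. univalence_root m M r)) \<and>
    (\<forall>r2. univalence_root m M r2 \<longrightarrow>
       inj_on F (ball 0 r2) \<and>
       contains_schlicht_disk F (ball 0 r2) 0 (schlicht_radius m M r2))"
proof -
  let ?c = "M 0 - 1 / M 0"
  have hol: "f k holomorphic_on ball 0 1" if "k < m" for k
    using assms(3) that by (auto simp: polyanalytic_with_def)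
  have F: "F z = f 0 z + (\<Sum>k\<in>{1..<m}. cnj z ^ k * f k z)" if "z \<in> ball 0 1" for z
  proof -
    have "{..<m} = insert 0 {1..<m}"
      using \<open>1 \<le> m\<close> by auto
    thus ?thesis
      using assms(3) that by (simp add: polyanalytic_with_def)
  qed
  have m: "0 < m"
    using \<open>1 \<le> m\<close> by simp
  have f00: "f 0 0 = 0" and Bf0: "\<And>z. z \<in> ball 0 1 \<Longrightarrow> norm (f 0 z) \<le> M 0"
    using assms(5,6) m by auto
  note hol0 = hol[OF m]
  have Mk: "0 \<le> M k" if "k \<in> {1..<m}" for k
    using assms(2) that by simp
  \<comment> \<open>The components with \<open>k \<ge> 1\<close> have derivative \<open>0\<close> at
    the origin, so \<open>F\<close> is complex differentiable there and its normalisation passes to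
    \<open>f 0\<close>.\<close>
  have f1: "deriv (f 0) 0 = 1"
  proof -
    have "((\<lambda>z. f 0 z + (\<Sum>k\<in>{1..<m}. cnj z ^ k * f k z)) has_field_derivative
        (deriv (f 0) 0 + (\<Sum>k\<in>{1..<m}. 0))) (at 0)"
      using assms(5) hol hol0
      by (intro DERIV_add DERIV_sum has_field_derivative_cnj_power_mult_0 holomorphic_derivI[of _ "ball 0 1"]) auto
    hence "(F has_field_derivative (deriv (f 0) 0 + (\<Sum>k\<in>{1..<m}. 0))) (at 0)"
      by (rule has_field_derivative_transform_within_open[of _ _ _ "ball 0 1"]) (use F in auto)
    thus ?thesis
      using wirtinger_z_eq_field_derivative assms(4) by fastforce
  qed
  have M0: "1 \<le> M 0"
    using norm_deriv_0_le[OF hol0 Bf0] f1 by simp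
  have c: "?c \<ge> 0"
    using M0 by (simp add: field_simps mult_ge1_I)
  have lipschitz: "norm ((F z - z) - (F w - w)) \<le> (1 - univalence_fun m M r) * norm (z - w)"
    if zw: "norm z \<le> r" "norm w \<le> r" and r: "r < 1" for z w r
  proof -
    have 1: "norm ((f 0 z - z) - (f 0 w - w)) \<le> (?c * ((2 - r) * r / (1 - r)\<^sup>2)) * norm (z - w)"
    proof (rule field_differentiable_bound[of "cball 0 r"])
      fix u :: complex assume u: "u \<in> cball 0 r"
      show "((\<lambda>z. f 0 z - z) has_field_derivative deriv (f 0) u - 1) (at u within cball 0 r)"
        using u r by (intro DERIV_diff DERIV_ident has_field_derivative_at_within[OF holomorphic_derivI[OF hol0]]) auto
      show "norm (deriv (f 0) u - 1) \<le> ?c * ((2 - r) * r / (1 - r)\<^sup>2)"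
        using u r by (intro norm_deriv_minus_one_le hol0 Bf0 f00 f1) auto
    qed (use zw in auto)
    have "(F z - z) - (F w - w) = ((f 0 z - z) - (f 0 w - w))
        + (\<Sum>k\<in>{1..<m}. cnj z ^ k * f k z - cnj w ^ k * f k w)"
      using zw r by (simp add: F sum_subtractf)
    also have "norm \<dots> \<le> norm ((f 0 z - z) - (f 0 w - w))
        + (\<Sum>k\<in>{1..<m}. norm (cnj z ^ k * f k z - cnj w ^ k * f k w))"
      by (intro norm_triangle_le add_left_mono norm_sum)
    also have "\<dots> \<le> (?c * ((2 - r) * r / (1 - r)\<^sup>2)) * norm (z - w)
        + (\<Sum>k\<in>{1..<m}. (r ^ k * (M k / (1 - r\<^sup>2)) + real k * r ^ k * M k) * norm (z - w))"
      using zw r assms(5,6) hol by (intro add_mono 1 sum_mono norm_cnj_power_mult_diff_le) auto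
    also have "\<dots> = (1 - univalence_fun m M r) * norm (z - w)"
      unfolding univalence_fun_def sum_distrib_right[symmetric] sum.distrib by (simp add: algebra_simps)
    finally show ?thesis .
  qed
  have inj: "inj_on F (ball 0 s)" if "univalence_root m M s" for s
  proof (rule inj_onI, rule ccontr)
    fix z w assume zw: "z \<in> ball 0 s" "w \<in> ball 0 s" "F z = F w" "z \<noteq> w"
    \<comment> \<open>At radius \<open>s\<close> the Lipschitz constant is exactly \<open>1\<close>.
      The larger of the two moduli lies strictly below \<open>s\<close>, where the constant is
      strictly smaller.\<close>
    define r where "r = max (norm z) (norm w)"
    have r: "0 < r" "r < s" "s < 1"
      using zw that by (auto simp: r_def univalence_root_def less_max_iff_disj)
    have "1 - univalence_fun m M r \<le> r / s * (1 - univalence_fun m M s)"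
      using r by (intro one_minus_univalence_fun_le M0 Mk) auto
    also have "\<dots> < 1"
      using r that by (simp add: univalence_root_def)
    finally have "(1 - univalence_fun m M r) * norm (z - w) < 1 * norm (z - w)"
      using zw by (intro mult_strict_right_mono) auto
    moreover have "norm (z - w) \<le> (1 - univalence_fun m M r) * norm (z - w)"
      using lipschitz[of z r w] r zw by (simp add: r_def norm_minus_commute)
    ultimately show False
      by simp
  qed
  have schlicht: "contains_schlicht_disk F (ball 0 s) 0 (schlicht_radius m M s)"
    if "univalence_root m M s" for s
  proof (rule contains_schlicht_diskI[OF _ inj[OF that]])
    show s: "0 < s"
      using that by (simp add: univalence_root_def)
    have s1: "s < 1"
      using that by (simp add: univalence_root_def)
    have "continuous_on (cball 0 s) (\<lambda>z. f 0 z + (\<Sum>k\<in>{1..<m}. cnj z ^ k * f k z))"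
      using s1 hol hol0
      by (intro continuous_intros continuous_on_subset[OF holomorphic_on_imp_continuous_on, of _ "ball 0 1"]) auto
    thus "continuous_on (cball 0 s) F"
      by (rule continuous_on_eq) (use F s1 in auto)
    show "F 0 = 0"
      using F[of 0] f00 assms(5) by simp
    fix z :: complex assume z: "norm z = s"
    have "F z - z = (f 0 z - z) + (\<Sum>k\<in>{1..<m}. cnj z ^ k * f k z)"
      using z s1 by (simp add: F)
    also have "norm \<dots> \<le> norm (f 0 z - z) + (\<Sum>k\<in>{1..<m}. norm (cnj z ^ k * f k z))"
      by (intro norm_triangle_le add_left_mono norm_sum)
    \<comment> \<open>These bounds are the terms that \<open>schlicht_radius\<close> subtracts from
      \<open>s\<close>, so the reverse triangle inequality with \<open>norm z = s\<close> yields the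
      boundary estimate.\<close>
    also have "\<dots> \<le> ?c * (s\<^sup>2 / (1 - s)) + (\<Sum>k\<in>{1..<m}. M k * s ^ k)"
    proof (intro add_mono sum_mono)
      show "norm (f 0 z - z) \<le> ?c * (s\<^sup>2 / (1 - s))"
        using z s1 by (intro norm_minus_id_le hol0 Bf0 f00 f1) auto
      show "norm (cnj z ^ k * f k z) \<le> M k * s ^ k" if "k \<in> {1..<m}" for k
        using that z s s1 assms(6)[of k z] by (simp add: norm_mult norm_power mult.commute mult_left_mono)
    qed
    finally have "norm (F z - z) \<le> s - schlicht_radius m M s"
      by (simp add: schlicht_radius_def)
    thus "schlicht_radius m M s \<le> norm (F z)"
      using z norm_triangle_ineq2[of z "F z"] by (simp add: norm_minus_commute)
  qed
  have "\<exists>!r. univalence_root m M r" if "M 0 \<noteq> 1 \<or> (\<exists>k\<in>{1..<m}. M k \<noteq> 0)"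
    using univalence_root_exists[of M m, OF M0 Mk that] univalence_root_unique[of M m, OF M0 Mk] by blast
  thus ?thesis
    using M0 inj schlicht by blast
qed

end
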